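(* Let $k, m \in \mathbb{N}$ and $R > 0$. Let $A \subset B_k(0,R)$ be a finite set such that $|p-q| \in \mathbb{N}$ for all distinct $p,q \in A$. Suppose that $\phi : B_k(0,R) \to \mathbb{R}^m$ satisfies $\phi(0) = 0$ and, for constants $0 < c_\phi \le C_\phi$, $$c_\phi |p-q|^{1/2} \le |\phi(p) - \phi(q)| \le C_\phi |p-q|^{1/2} \quad \text{for all } p,q \in B_k(0,R).$$ Set $$\delta_\phi := \frac{2c_\phi^2}{3C_\phi^2 + 2c_\phi^2}.$$ If $0 < \delta \le \delta_\phi$ and $\lambda$ is a real number satisfying $$\frac{\sqrt{3\delta}}{c_\phi} \le \lambda \le \frac{\sqrt{2(1-\delta)}}{C_\phi},$$ then the set $P_\lambda(A) := \{(p, \lambda\phi(p)) : p \in A\} \subset \mathbb{R}^{k+m}$ satisfies $$\big\|\,|u - v|\,\big\| \ge \delta \quad \text{for all distinct } u,v \in P_\lambda(A).$$ Moreover, $P_\lambda(A)$ is contained in the closed Euclidean ball of radius $(R^2+2R)^{1/2}$ centred at the origin of $\mathbb{R}^{k+m}$.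
   Context: $\mathbb{N} = \{1,2,3,\dots\}$. $|\cdot|$ denotes the Euclidean norm, $B_k(0,R)$ is the closed Euclidean ball of radius $R$ centred at the origin in $\mathbb{R}^k$, and for a real number $t$, $\|t\|$ is the distance from $t$ to the nearest integer. *)

theory Defs
  imports "HOL-Analysis.Analysis"
begin

definition dist_nearest_int :: "real \<Rightarrow> real" where
  "dist_nearest_int t = \<bar>t - of_int (round t)\<bar>"

definition delta_thr :: "real \<Rightarrow> real \<Rightarrow> real" where
  "delta_thr c C = 2 * c\<^sup>2 / (3 * C\<^sup>2 + 2 * c\<^sup>2)"

text \<open>
  The space \<open>\<real>\<^bsup>k+m\<^esup>\<close> is represented by the product \<open>(real ^ 'k) \<times> (real ^ 'm)\<close>. The library norm on a
  product is \<open>norm (x, y) = sqrt ((norm x)\<^sup>2 + (norm y)\<^sup>2)\<close>, that is, the Euclidean norm on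
  \<open>\<real>\<^bsup>k+m\<^esup>\<close>.
\<close>

definition lifted_set ::
    "real \<Rightarrow> (real ^ 'k \<Rightarrow> real ^ 'm) \<Rightarrow> (real ^ 'k) set \<Rightarrow> ((real ^ 'k) \<times> (real ^ 'm)) set" where
  "lifted_set l \<phi> A = {(p, l *\<^sub>R \<phi> p) |p. p \<in> A}"

end

theory Submission
  imports Defs
begin

text \<open>
  For points at integer distance \<open>n \<ge> 1\<close>, the lift turns \<open>n\<^sup>2\<close> into a number between
  \<open>n\<^sup>2 + 3\<delta>n \<ge> (n + \<delta>)\<^sup>2\<close> and \<open>n\<^sup>2 + 2(1 - \<delta>)n \<le> (n + 1 - \<delta>)\<^sup>2\<close>, so the new distance stays
  between \<open>n + \<delta>\<close> and \<open>n + 1 - \<delta>\<close>.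
\<close>

text \<open>An integer is either at most \<open>n\<close> or at least \<open>n + 1\<close>; on
  either side it stays at least \<delta> away from \<open>t\<close>, and this applies to
  \<open>round t\<close>.\<close>

lemma dist_nearest_int_ge:
  assumes "of_int n + \<delta> \<le> t" and "t \<le> of_int n + 1 - \<delta>"
  shows "\<delta> \<le> dist_nearest_int t"
proof -
  consider "round t \<le> n" | "n + 1 \<le> round t" by linarith
  then show ?thesis
  proof cases
    case 1
    then have "real_of_int (round t) \<le> of_int n" by simp
    with assms show ?thesis unfolding dist_nearest_int_def by linarith
  next
    case 2
    then have "real_of_int (n + 1) \<le> of_int (round t)" by (simp only: of_int_le_iff)
    with assms show ?thesis unfolding dist_nearest_int_def by simp
  qed
qed

text \<open>The threshold is the largest \<delta> with \<open>3 * \<delta> * C\<^sup>2 \<le> 2 * (1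
  - \<delta>) * c\<^sup>2\<close>, that is, the largest for which some scaling \<open>l\<close> is
  admissible. Being below 1, it keeps the radicand \<open>2 * (1 - \<delta>)\<close>
  nonnegative.\<close>

lemma delta_thr_less_1:
  assumes "0 < c" and "0 < C"
  shows "delta_thr c C < 1"
  using assms by (simp add: delta_thr_def divide_less_eq add_pos_pos)

text \<open>Squaring turns the exponent 1/2 into linear growth, the same order as the cross term
  \<open>2 * \<delta> * n\<close> of \<open>(n + \<delta>)\<^sup>2\<close>.\<close>

lemma powr_half_bounds_power2:
  fixes x y :: real
  assumes "0 < c" and "0 < C" and "0 \<le> x"
    and "c * x powr (1/2) \<le> y" and "y \<le> C * x powr (1/2)"
  shows "c\<^sup>2 * x \<le> y\<^sup>2" and "y\<^sup>2 \<le> C\<^sup>2 * x"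
proof -
  have x: "(x powr (1/2))\<^sup>2 = x"
    using assms(3) by (simp add: powr_half_sqrt)
  have "0 \<le> c * x powr (1/2)" using assms(1) by simp
  then have "(c * x powr (1/2))\<^sup>2 \<le> y\<^sup>2" "y\<^sup>2 \<le> (C * x powr (1/2))\<^sup>2"
    using assms(4,5) by (auto intro!: power_mono)
  then show "c\<^sup>2 * x \<le> y\<^sup>2" and "y\<^sup>2 \<le> C\<^sup>2 * x"
    by (simp_all add: power_mult_distrib x)
qed

lemma sqrt_near_integer:
  fixes n \<delta> s :: real
  assumes "1 \<le> n" and "0 \<le> \<delta>" and "\<delta> \<le> 1"
    and "3 * \<delta> * n \<le> s" and "s \<le> 2 * (1 - \<delta>) * n"
  shows "n + \<delta> \<le> sqrt (n\<^sup>2 + s)" and "sqrt (n\<^sup>2 + s) \<le> n + 1 - \<delta>"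
proof -
  have "\<delta> * \<delta> \<le> \<delta> * n"
    using assms(1-3) by (intro mult_left_mono) auto
  then have "(n + \<delta>)\<^sup>2 \<le> n\<^sup>2 + s"
    using assms(4) by (simp add: power2_eq_square algebra_simps)
  then show "n + \<delta> \<le> sqrt (n\<^sup>2 + s)"
    by (rule real_le_rsqrt)
  have "(n + (1 - \<delta>))\<^sup>2 = n\<^sup>2 + 2 * (1 - \<delta>) * n + (1 - \<delta>)\<^sup>2"
    by (simp add: power2_eq_square algebra_simps)
  then have "n\<^sup>2 + s \<le> (n + (1 - \<delta>))\<^sup>2"
    using assms(5) zero_le_power2[of "1 - \<delta>"] by linarith
  then show "sqrt (n\<^sup>2 + s) \<le> n + 1 - \<delta>"
    using assms(1,3) by (intro real_le_lsqrt) (auto simp: add_diff_eq)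
qed

theorem lemma3p3:
  fixes R c C \<delta> l :: real
    and A :: "(real ^ 'k) set"
    and \<phi> :: "real ^ 'k \<Rightarrow> real ^ 'm"
  assumes "R > 0"
    and "finite A" and "A \<subseteq> cball 0 R"
    and "\<forall>p\<in>A. \<forall>q\<in>A. p \<noteq> q \<longrightarrow> norm (p - q) \<in> \<nat> - {0}"
    and "\<phi> 0 = 0"
    and "0 < c" and "c \<le> C"
    and "\<forall>p\<in>cball 0 R. \<forall>q\<in>cball 0 R.
           c * norm (p - q) powr (1/2) \<le> norm (\<phi> p - \<phi> q) \<and>
           norm (\<phi> p - \<phi> q) \<le> C * norm (p - q) powr (1/2)"
    and "0 < \<delta>" and "\<delta> \<le> delta_thr c C"
    and "sqrt (3 * \<delta>) / c \<le> l" and "l \<le> sqrt (2 * (1 - \<delta>)) / C"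
  shows "(\<forall>u\<in>lifted_set l \<phi> A. \<forall>v\<in>lifted_set l \<phi> A. u \<noteq> v \<longrightarrow>
            dist_nearest_int (norm (u - v)) \<ge> \<delta>) \<and>
         lifted_set l \<phi> A \<subseteq> cball 0 ((R\<^sup>2 + 2 * R) powr (1/2))"
proof -
  have C: "0 < C" using assms(6,7) by linarith
  have \<delta>1: "\<delta> \<le> 1" using delta_thr_less_1[OF assms(6) C] assms(10) by linarith
  have "0 \<le> sqrt (3 * \<delta>) / c" using assms(6,9) by simp
  with assms(11) have l: "0 \<le> l" by linarith
  have "sqrt (3 * \<delta>) \<le> l * c"
    using assms(6,11) by (simp add: pos_divide_le_eq)
  then have "(sqrt (3 * \<delta>))\<^sup>2 \<le> (l * c)\<^sup>2"
    using assms(9) by (intro power_mono) auto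
  then have lc: "3 * \<delta> \<le> l\<^sup>2 * c\<^sup>2"
    using assms(9) by (simp add: power_mult_distrib)
  have "l * C \<le> sqrt (2 * (1 - \<delta>))"
    using C assms(12) by (simp add: pos_le_divide_eq)
  then have "(l * C)\<^sup>2 \<le> (sqrt (2 * (1 - \<delta>)))\<^sup>2"
    using l C by (intro power_mono) auto
  \<comment> \<open>For negative \<open>x\<close> the value \<open>sqrt x\<close> is
    \<open>- sqrt (- x)\<close>, so undoing the root needs \<open>\<delta>1\<close>.\<close>
  then have lC: "l\<^sup>2 * C\<^sup>2 \<le> 2 * (1 - \<delta>)"
    using \<delta>1 by (simp add: power_mult_distrib)
  \<comment> \<open>Stated on the whole ball rather than on \<open>A\<close>, so that the origin,
    which may lie outside \<open>A\<close>, can serve as \<open>q\<close> in the containment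
    proof.\<close>
  have lift: "3 * \<delta> * norm (p - q) \<le> l\<^sup>2 * (norm (\<phi> p - \<phi> q))\<^sup>2
      \<and> l\<^sup>2 * (norm (\<phi> p - \<phi> q))\<^sup>2 \<le> 2 * (1 - \<delta>) * norm (p - q)"
    if "p \<in> cball 0 R" "q \<in> cball 0 R" for p q
  proof -
    have "c\<^sup>2 * norm (p - q) \<le> (norm (\<phi> p - \<phi> q))\<^sup>2" "(norm (\<phi> p - \<phi> q))\<^sup>2 \<le> C\<^sup>2 * norm (p - q)"
      using powr_half_bounds_power2[OF assms(6) C norm_ge_zero] assms(8) that by blast+
    then have "l\<^sup>2 * (c\<^sup>2 * norm (p - q)) \<le> l\<^sup>2 * (norm (\<phi> p - \<phi> q))\<^sup>2"
      "l\<^sup>2 * (norm (\<phi> p - \<phi> q))\<^sup>2 \<le> l\<^sup>2 * (C\<^sup>2 * norm (p - q))"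
      by (auto intro: mult_left_mono)
    moreover have "3 * \<delta> * norm (p - q) \<le> l\<^sup>2 * c\<^sup>2 * norm (p - q)"
      "l\<^sup>2 * C\<^sup>2 * norm (p - q) \<le> 2 * (1 - \<delta>) * norm (p - q)"
      using lc lC by (auto intro: mult_right_mono)
    ultimately show ?thesis by (simp add: mult.assoc)
  qed
  have "\<delta> \<le> dist_nearest_int (norm (u - v))"
    if u: "u \<in> lifted_set l \<phi> A" and v: "v \<in> lifted_set l \<phi> A" and "u \<noteq> v" for u v
  proof -
    \<comment> \<open>Points of the lift over the same base point coincide, so distinct
      \<open>u\<close> and \<open>v\<close> have distinct base points.\<close>
    obtain p q where p: "p \<in> A" "u = (p, l *\<^sub>R \<phi> p)" and q: "q \<in> A" "v = (q, l *\<^sub>R \<phi> q)"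
      using u v unfolding lifted_set_def by auto
    with \<open>u \<noteq> v\<close> have "norm (p - q) \<in> \<nat>" "norm (p - q) \<noteq> 0" using assms(4) by auto
    then obtain n :: nat where n: "norm (p - q) = real n" "1 \<le> real n"
      by (metis Nats_cases of_nat_0 of_nat_1 of_nat_le_iff less_one not_le)
    \<comment> \<open>Pythagoras in the product: the squared distance is
      \<open>n\<^sup>2 + s\<close>, with \<open>s\<close> the quantity bounded in
      \<open>lift\<close>.\<close>
    have "norm (u - v) = sqrt ((real n)\<^sup>2 + l\<^sup>2 * (norm (\<phi> p - \<phi> q))\<^sup>2)"
      using l by (simp add: p q norm_Pair n power_mult_distrib flip: scaleR_diff_right)
    moreover have "p \<in> cball 0 R" "q \<in> cball 0 R" using p q assms(3) by blast+
    ultimately have "of_int (int n) + \<delta> \<le> norm (u - v)" "norm (u - v) \<le> of_int (int n) + 1 - \<delta>"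
      using sqrt_near_integer[OF n(2) _ \<delta>1] lift[of p q] assms(9) n(1) by simp_all
    then show ?thesis by (rule dist_nearest_int_ge)
  qed
  moreover have "w \<in> cball 0 ((R\<^sup>2 + 2 * R) powr (1/2))" if w: "w \<in> lifted_set l \<phi> A" for w
  proof -
    obtain p where p: "p \<in> A" "w = (p, l *\<^sub>R \<phi> p)"
      using w unfolding lifted_set_def by auto
    then have pR: "p \<in> cball 0 R" "norm p \<le> R" using assms(3) by auto
    \<comment> \<open>With \<open>q = 0\<close> and \<open>\<phi> 0 = 0\<close>, the bound on
      differences becomes a bound on \<open>\<phi> p\<close> itself.\<close>
    have "l\<^sup>2 * (norm (\<phi> p))\<^sup>2 \<le> 2 * (1 - \<delta>) * norm p"
      using lift[OF pR(1), of 0] assms(1,5) by simp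
    also have "\<dots> \<le> 2 * R"
      using pR \<delta>1 assms(9) by (intro mult_mono) auto
    finally have "l\<^sup>2 * (norm (\<phi> p))\<^sup>2 \<le> 2 * R" .
    moreover have "(norm p)\<^sup>2 \<le> R\<^sup>2" using pR by (intro power_mono) auto
    ultimately have "norm w \<le> sqrt (R\<^sup>2 + 2 * R)"
      using l by (simp add: p norm_Pair power_mult_distrib)
    then show ?thesis using assms(1) by (simp add: powr_half_sqrt)
  qed
  ultimately show ?thesis by blast
qed

end
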